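(* Let $-1<\alpha<0$, $-1<\beta$, and let $n\geqslant4$ be an integer. Define $$\Phi_n(x;\mu)=\sum_{k=0}^{n}\Big(\frac{d^k}{dx^k}P_n^{(\alpha,\beta-1)}(x)\Big)\mu^k .$$ Then every zero $\mu\in\mathbb{C}$ of the polynomial $\mu\mapsto\Phi_n(1;\mu)$ satisfies $\operatorname{Re}\mu<0$.
   Context: For real $a$ and integer $m\geqslant0$, $(a)_m=a(a+1)\cdots(a+m-1)$, $(a)_0=1$. For real $\alpha>-1$ and real $\beta$, the Jacobi polynomial is $$P_n^{(\alpha,\beta)}(x)=\frac{(\alpha+1)_n}{n!}\sum_{k=0}^{n}\frac{(-n)_k(n+\alpha+\beta+1)_k}{k!\,(\alpha+1)_k}\Big(\frac{1-x}{2}\Big)^k$$ (this formula is used also when the second parameter is $\le -1$). *)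

theory Defs
  imports Complex_Main "HOL-Computational_Algebra.Polynomial"
begin

text \<open>Jacobi polynomial P_n^(a,b) as a real polynomial in x, via the explicit
  hypergeometric formula (used for any real b).  pochhammer a m is the rising
  factorial (a)_m.\<close>
definition jacobi_poly :: "real \<Rightarrow> real \<Rightarrow> nat \<Rightarrow> real poly" where
  "jacobi_poly a b n =
     smult (pochhammer (a + 1) n / fact n)
       (\<Sum>k=0..n. smult (pochhammer (- real n) k * pochhammer (real n + a + b + 1) k
                          / (fact k * pochhammer (a + 1) k))
                       ([:1/2, -1/2:] ^ k))"

definition Phi :: "real \<Rightarrow> real \<Rightarrow> nat \<Rightarrow> real \<Rightarrow> complex \<Rightarrow> complex" where
  "Phi a b n x \<mu> =
     (\<Sum>k=0..n. complex_of_real (poly ((pderiv ^^ k) (jacobi_poly a (b - 1) n)) x) * \<mu> ^ k)"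

end

theory Submission
  imports Defs "HOL-Analysis.Gamma_Function"
begin

text \<open>
  Put \<open>t = (1 - x) / 2\<close>, \<open>\<nu> = - \<mu> / 2\<close>, let \<open>p(t)\<close> be the Jacobi polynomial in the variable \<open>t\<close>,
  and let \<open>U = (\<Sum>k\<le>n. \<nu> ^ k * p\<^sup>(\<^sup>k\<^sup>))\<close>. Then \<open>U - \<nu> U' = p\<close>, and \<open>\<mu>\<close> is a zero of \<open>\<Phi>\<^sub>n(1; \<cdot>)\<close>
  exactly when \<open>U(0) = 0\<close>. Test this equation against \<open>(1 - t)\<close> times the conjugate of \<open>U'\<close> with
  respect to the weight \<open>t\<^sup>\<alpha> (1 - t)\<^sup>\<beta>\<close>, and suppose \<open>Re \<nu> \<le> 0\<close>. Integration by parts, using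
  \<open>U(0) = 0\<close> and \<open>\<alpha> \<le> 0\<close>, shows that the real part of the left-hand side is nonnegative. As \<open>p\<close> is
  orthogonal to all polynomials of degree at most \<open>n - 2\<close>, on the right-hand side only the two
  leading coefficients of \<open>(1 - t) U'\<close> matter, and its real part is negative.
\<close>

section \<open>Alternating binomial sums\<close>

text \<open>Pascal's rule followed by an index shift. Up to sign the alternating sum is the
  \<open>n\<close>-th finite difference of \<open>f\<close> at 0, so one difference is split off
  here.\<close>

lemma alternating_binomial_sum_Suc:
  fixes f :: "nat \<Rightarrow> real"
  shows "(\<Sum>k\<le>Suc n. (-1) ^ k * real (Suc n choose k) * f k) =
    (\<Sum>k\<le>n. (-1) ^ k * real (n choose k) * (f k - f (Suc k)))"
proof -
  have A: "(\<Sum>k\<le>Suc n. (-1) ^ k * real (n choose k) * f k) = (\<Sum>k\<le>n. (-1) ^ k * real (n choose k) * f k)"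
    by simp
  have B: "(\<Sum>k\<le>Suc n. (-1) ^ k * real (n choose k) * f k) =
     f 0 + (\<Sum>k\<le>n. (-1) ^ Suc k * real (n choose Suc k) * f (Suc k))"
    by (subst sum.atMost_Suc_shift) simp
  have "(\<Sum>k\<le>Suc n. (-1) ^ k * real (Suc n choose k) * f k) =
     f 0 + (\<Sum>k\<le>n. (-1) ^ Suc k * real (n choose Suc k) * f (Suc k)) -
     (\<Sum>k\<le>n. (-1) ^ k * real (n choose k) * f (Suc k))"
    by (subst sum.atMost_Suc_shift) (simp add: algebra_simps sum.distrib sum_negf sum_subtractf)
  also have "\<dots> = (\<Sum>k\<le>n. (-1) ^ k * real (n choose k) * (f k - f (Suc k)))"
    using A B by (simp add: algebra_simps sum_subtractf)
  finally show ?thesis .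
qed

text \<open>Each difference lowers the degree, because \<open>q(x)\<close> and
  \<open>q(x + 1)\<close> share their leading coefficient. The alternative \<open>q = 0\<close> is
  what remains at \<open>n = 0\<close>.\<close>

lemma alternating_binomial_sum_poly:
  fixes q :: "real poly"
  assumes "q = 0 \<or> degree q < n"
  shows "(\<Sum>k\<le>n. (-1) ^ k * real (n choose k) * poly q (real k)) = 0"
  using assms
proof (induction n arbitrary: q)
  case 0
  then show ?case by simp
next
  case (Suc n)
  define r where "r = q - pcompose q [:1, 1:]"
  have "r = 0 \<or> degree r < n"
  proof (cases "degree q = 0")
    case True
    then obtain c where "q = [:c:]" by (meson degree_eq_zeroE)
    then show ?thesis by (simp add: r_def pcompose_const)
  next
    case False
    have "degree r \<le> degree q" "coeff r (degree q) = 0"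
      unfolding r_def
    proof -
      show "degree (q - pcompose q [:1, 1:]) \<le> degree q"
        by (rule degree_diff_le) (simp_all add: degree_pcompose)
      have "lead_coeff (pcompose q [:1, 1:]) = lead_coeff q"
        by (subst lead_coeff_comp) simp_all
      then show "coeff (q - pcompose q [:1, 1:]) (degree q) = 0"
        by (simp add: degree_pcompose)
    qed
    then show ?thesis
      using Suc.prems False degree_less_if_less_eqI[of r q] by (cases "r = 0") auto
  qed
  then have "(\<Sum>k\<le>n. (-1) ^ k * real (n choose k) * poly r (real k)) = 0"
    by (rule Suc.IH)
  then show ?case
    unfolding alternating_binomial_sum_Suc by (simp add: r_def poly_pcompose add_ac)
qed

text \<open>The left side is the partial fraction expansion of the right side in \<open>m\<close>.
  The induction step subtracts the cases \<open>m\<close> and \<open>m + 1\<close>.\<close>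

lemma alternating_binomial_sum_inverse:
  fixes m :: real
  assumes "m > 0"
  shows "(\<Sum>k\<le>n. (-1) ^ k * real (n choose k) * (1 / (m + real k))) = fact n / pochhammer m (Suc n)"
  using assms
proof (induction n arbitrary: m)
  case 0
  then show ?case by simp
next
  case (Suc n)
  have pos: "pochhammer (m + 1) n > 0"
    using Suc.prems by (auto intro!: pochhammer_pos)
  have e1: "pochhammer m (Suc n) = m * pochhammer (m + 1) n"
    by (rule pochhammer_rec)
  have e2: "pochhammer (m + 1) (Suc n) = pochhammer (m + 1) n * (m + 1 + real n)"
    by (simp add: pochhammer_Suc)
  have e3: "pochhammer m (Suc (Suc n)) = m * pochhammer (m + 1) n * (m + 1 + real n)"
    by (subst pochhammer_rec) (simp add: pochhammer_Suc)
  have "(\<Sum>k\<le>Suc n. (-1) ^ k * real (Suc n choose k) * (1 / (m + real k))) =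
      (\<Sum>k\<le>n. (-1) ^ k * real (n choose k) * (1 / (m + real k))) -
      (\<Sum>k\<le>n. (-1) ^ k * real (n choose k) * (1 / (m + 1 + real k)))"
    unfolding alternating_binomial_sum_Suc
    by (simp add: sum_subtractf algebra_simps diff_divide_distrib)
  also have "\<dots> = fact n / pochhammer m (Suc n) - fact n / pochhammer (m + 1) (Suc n)"
    using Suc.IH[of m] Suc.IH[of "m + 1"] Suc.prems by simp
  also have "\<dots> = fact (Suc n) / pochhammer m (Suc (Suc n))"
  proof -
    have "F / (m * P) - F / (P * (m + 1 + real n)) = (1 + real n) * F / (m * P * (m + 1 + real n))"
      if "P > 0" for F P :: real
    proof -
      have "m + 1 + real n > 0" using Suc.prems by simp
      then show ?thesis
        using that Suc.prems by (simp add: divide_simps) (simp add: algebra_simps)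
    qed
    from this[OF pos, of "fact n"] show ?thesis
      unfolding e1 e2 e3 by (simp add: algebra_simps)
  qed
  finally show ?case .
qed

section \<open>The Jacobi weight on the unit interval\<close>

text \<open>Up to a constant this integrates over [-1, 1] against the Jacobi weight
  \<open>(1 - x)^a (1 + x)^b\<close>, written in \<open>t = (1 - x) / 2\<close>. Its argument is a
  real polynomial, so the complex \<open>U\<close> enters through its real and imaginary
  parts.\<close>

definition jacobi_integral :: "real \<Rightarrow> real \<Rightarrow> real poly \<Rightarrow> real" where
  "jacobi_integral a b f = integral {0..1} (\<lambda>t. poly f t * (t powr a * (1 - t) powr b))"

lemma has_integral_monom:
  assumes "-1 < a" "-1 < b"
  shows "((\<lambda>t. t ^ k * (t powr a * (1 - t) powr b)) has_integral
           Beta (a + 1 + real k) (b + 1)) {0..1}"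
proof -
  have "((\<lambda>t. t powr (a + 1 + real k - 1) * (1 - t) powr (b + 1 - 1)) has_integral
           Beta (a + 1 + real k) (b + 1)) {0..1}"
    using assms by (intro has_integral_Beta_real) auto
  then show ?thesis
  proof (rule has_integral_eq[rotated])
    fix t :: real assume "t \<in> {0..1}"
    then show "t powr (a + 1 + real k - 1) * (1 - t) powr (b + 1 - 1) =
        t ^ k * (t powr a * (1 - t) powr b)"
      \<comment> \<open>At \<open>t = 0\<close> both sides are 0, even for \<open>k = 0\<close>,
        since \<open>0 powr y = 0\<close> for every \<open>y\<close>.\<close>
      by (cases "t = 0") (auto simp: powr_add powr_realpow mult_ac)
  qed
qed

lemma has_integral_jacobi_integral:
  assumes "-1 < a" "-1 < b"
  shows "((\<lambda>t. poly f t * (t powr a * (1 - t) powr b)) has_integral jacobi_integral a b f) {0..1}"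
proof -
  have "((\<lambda>t. \<Sum>i\<le>degree f. coeff f i * (t ^ i * (t powr a * (1 - t) powr b))) has_integral
      (\<Sum>i\<le>degree f. coeff f i * Beta (a + 1 + real i) (b + 1))) {0..1}"
    by (intro has_integral_sum has_integral_mult_right has_integral_monom assms) auto
  then have "(\<lambda>t. poly f t * (t powr a * (1 - t) powr b)) integrable_on {0..1}"
    unfolding poly_altdef integrable_on_def sum_distrib_right mult.assoc by blast
  then show ?thesis
    unfolding jacobi_integral_def by (rule integrable_integral)
qed

context
  fixes a b :: real
  assumes ab: "-1 < a" "-1 < b"
begin

lemma jacobi_integral_monom:
  "jacobi_integral a b (monom c k) = c * Beta (a + 1 + real k) (b + 1)"
  unfolding jacobi_integral_def poly_monom mult.assoc
  by (intro integral_unique has_integral_mult_right has_integral_monom ab)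

lemma jacobi_integral_0 [simp]: "jacobi_integral a b 0 = 0"
  by (simp add: jacobi_integral_def)

lemma jacobi_integral_add:
  "jacobi_integral a b (f + g) = jacobi_integral a b f + jacobi_integral a b g"
  unfolding jacobi_integral_def[of _ _ "f + g"] poly_add ring_distribs
  by (intro integral_unique has_integral_add has_integral_jacobi_integral ab)

lemma jacobi_integral_smult:
  "jacobi_integral a b (smult c f) = c * jacobi_integral a b f"
  unfolding jacobi_integral_def[of _ _ "smult c f"] poly_smult mult.assoc
  by (intro integral_unique has_integral_mult_right has_integral_jacobi_integral ab)

lemma jacobi_integral_diff:
  "jacobi_integral a b (f - g) = jacobi_integral a b f - jacobi_integral a b g"
  using jacobi_integral_add[of "f - g" g] by simp

lemma jacobi_integral_sum:
  "jacobi_integral a b (\<Sum>i\<in>A. f i) = (\<Sum>i\<in>A. jacobi_integral a b (f i))"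
  by (induction A rule: infinite_finite_induct) (auto simp: jacobi_integral_add)

lemma jacobi_integral_nonneg:
  assumes "\<And>t. 0 \<le> t \<Longrightarrow> t \<le> 1 \<Longrightarrow> poly f t \<ge> 0"
  shows "jacobi_integral a b f \<ge> 0"
  by (rule has_integral_nonneg[OF has_integral_jacobi_integral[OF ab, of f]]) (auto intro!: mult_nonneg_nonneg assms)


text \<open>The integrand is the derivative of \<open>t^(a+1) (1-t)^(b+1) f(t)\<close>, which
  vanishes at both ends. For a monomial \<open>f\<close> the claim reduces to the recurrence of
  \<open>Beta\<close> in its first argument.\<close>

lemma jacobi_integral_by_parts_monom:
  "jacobi_integral a b ([:0, 1, -1:] * pderiv (monom c k) + [:a + 1, - (a + b + 2):] * monom c k) = 0"
proof -
  have rec: "(a + b + 2 + real k) * Beta (a + 1 + real (Suc k)) (b + 1) =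
      (a + 1 + real k) * Beta (a + 1 + real k) (b + 1)"
  proof -
    have "a + 1 + real k \<notin> \<int>\<^sub>\<le>\<^sub>0"
      using ab by (auto elim!: nonpos_Ints_cases)
    from Beta_plus1_left[OF this, of "b + 1"] show ?thesis
      by (simp add: add_ac)
  qed
  have "[:0, 1, -1:] * pderiv (monom c k) + [:a + 1, - (a + b + 2):] * monom c k =
     monom ((a + 1 + real k) * c) k - monom ((a + b + 2 + real k) * c) (Suc k)"
    by (subst poly_eq_poly_eq_iff[symmetric], cases k)
       (simp_all add: fun_eq_iff pderiv_monom poly_monom algebra_simps)
  then show ?thesis
    using rec by (simp only: jacobi_integral_diff jacobi_integral_monom) (simp add: mult_ac)
qed

lemma jacobi_integral_by_parts:
  "jacobi_integral a b ([:0, 1, -1:] * pderiv f + [:a + 1, - (a + b + 2):] * f) = 0"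
proof -
  let ?g = "\<lambda>f. [:0, 1, -1:] * pderiv f + [:a + 1, - (a + b + 2):] * f"
  have "?g (\<Sum>i\<le>degree f. monom (coeff f i) i) = (\<Sum>i\<le>degree f. ?g (monom (coeff f i) i))"
    by (simp only: higher_pderiv_sum[of 1, simplified] sum.distrib sum_distrib_left)
  then have "?g f = (\<Sum>i\<le>degree f. ?g (monom (coeff f i) i))"
    by (simp only: poly_as_sum_of_monoms)
  then show ?thesis
    by (simp only: jacobi_integral_sum jacobi_integral_by_parts_monom) simp
qed

text \<open>The zero at 0 gives \<open>f = t v\<close> and \<open>f^2 = t g\<close> with
  \<open>g = t v^2\<close>, so integrating \<open>(f^2)'\<close> by parts meets no singular factor
  \<open>t^(a-1)\<close>. What remains is \<open>g\<close> times \<open>-a (1-t) + (b+1) t\<close>,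
  nonnegative on [0, 1] because \<open>a \<le> 0\<close>.\<close>

lemma jacobi_integral_energy_nonneg:
  assumes "a \<le> 0" "poly f 0 = 0"
  shows "jacobi_integral a b ([:1, -1:] * (f * pderiv f)) \<ge> 0"
proof -
  obtain v where v: "f = [:0, 1:] * v"
    using assms(2) by (auto simp: poly_eq_0_iff_dvd elim!: dvdE)
  define g where "g = [:0, 1:] * v ^ 2"
  have fg: "f * f = [:0, 1:] * g"
    by (simp add: v g_def power2_eq_square)
  have "pderiv (f * f) = pderiv ([:0, 1:] * g)" by (simp only: fg)
  then have "2 * (f * pderiv f) = g + [:0, 1:] * pderiv g"
    by (simp add: pderiv_mult pderiv_pCons algebra_simps)
  then have "smult 2 ([:1, -1:] * (f * pderiv f)) = [:1, -1:] * (g + [:0, 1:] * pderiv g)"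
    by (metis mult_smult_right numeral_mult_conv_smult)
  also have "\<dots> = ([:0, 1, -1:] * pderiv g + [:a + 1, - (a + b + 2):] * g) + [:- a, a + b + 1:] * g"
    by (subst poly_eq_poly_eq_iff[symmetric]) (simp add: fun_eq_iff algebra_simps)
  finally have "2 * jacobi_integral a b ([:1, -1:] * (f * pderiv f)) =
      jacobi_integral a b ([:- a, a + b + 1:] * g)"
    by (metis jacobi_integral_smult jacobi_integral_add jacobi_integral_by_parts add_0)
  moreover have "jacobi_integral a b ([:- a, a + b + 1:] * g) \<ge> 0"
  proof (rule jacobi_integral_nonneg)
    fix t :: real assume t: "0 \<le> t" "t \<le> 1"
    have "(- a) * (1 - t) \<ge> 0" "(b + 1) * t \<ge> 0"
      using t ab assms by (intro mult_nonneg_nonneg; linarith)+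
    then have "- a * (1 - t) + (b + 1) * t \<ge> 0" by linarith
    moreover have "poly ([:- a, a + b + 1:] * g) t = (- a * (1 - t) + (b + 1) * t) * (t * (poly v t)\<^sup>2)"
      by (simp add: g_def algebra_simps)
    ultimately show "poly ([:- a, a + b + 1:] * g) t \<ge> 0"
      using t by simp
  qed
  ultimately show ?thesis by simp
qed


text \<open>Expand \<open>q\<close> in powers. It is applied with \<open>k = n - 1\<close>, the
  first moment that quasi-orthogonality does not kill.\<close>

lemma jacobi_integral_reduce_degree:
  assumes orth: "\<And>j. j < k \<Longrightarrow> jacobi_integral a b (f * monom 1 j) = 0"
    and "degree q \<le> k"
  shows "jacobi_integral a b (f * q) = coeff q k * jacobi_integral a b (f * monom 1 k)"
proof -
  have "f * q = (\<Sum>i\<le>k. smult (coeff q i) (f * monom 1 i))"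
    by (subst poly_as_sum_of_monoms'[OF assms(2), symmetric])
       (simp add: sum_distrib_left smult_monom flip: mult_smult_right)
  then have "jacobi_integral a b (f * q) = (\<Sum>i\<le>k. coeff q i * jacobi_integral a b (f * monom 1 i))"
    by (simp add: jacobi_integral_sum jacobi_integral_smult)
  also have "\<dots> = (\<Sum>i\<in>{k}. coeff q i * jacobi_integral a b (f * monom 1 i))"
    by (rule sum.mono_neutral_right) (auto simp: orth)
  finally show ?thesis by simp
qed

end

section \<open>Quasi-orthogonality\<close>

text \<open>Up to a constant factor, \<open>P\<^sub>n\<^sup>(\<^sup>a\<^sup>,\<^sup>b\<^sup>-\<^sup>1\<^sup>)(1 - 2 t)\<close> where \<open>m = n + a + b\<close>.\<close>

definition unit_jacobi :: "real \<Rightarrow> real \<Rightarrow> nat \<Rightarrow> real poly" where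
  "unit_jacobi a m n =
    (\<Sum>k\<le>n. monom ((-1) ^ k * real (n choose k) * (pochhammer m k / pochhammer (a + 1) k)) k)"

lemma coeff_unit_jacobi:
  "coeff (unit_jacobi a m n) k =
    (if k \<le> n then (-1) ^ k * real (n choose k) * (pochhammer m k / pochhammer (a + 1) k) else 0)"
  by (simp add: unit_jacobi_def coeff_sum)

lemma degree_unit_jacobi_le: "degree (unit_jacobi a m n) \<le> n"
  by (rule degree_le) (simp add: coeff_unit_jacobi)

text \<open>Both sides are \<open>pochhammer x (j + k)\<close>. The swap moves \<open>k\<close> from
  the number of factors to the base point, where the dependence on \<open>k\<close> is
  polynomial.\<close>

lemma pochhammer_shift_swap:
  fixes x :: real
  shows "pochhammer (x + real j) k * pochhammer x j = pochhammer (x + real k) j * pochhammer x k"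
  using pochhammer_product'[of x j k] pochhammer_product'[of x k j] by (simp add: add.commute mult.commute)

lemma Beta_add_nat:
  fixes x y :: real
  assumes "x > 0" "y > 0"
  shows "Beta (x + real k) y = Beta x y * (pochhammer x k / pochhammer (x + y) k)"
proof (induction k)
  case 0
  then show ?case by simp
next
  case (Suc k)
  have "x + real k \<notin> \<int>\<^sub>\<le>\<^sub>0"
    using assms by (auto elim!: nonpos_Ints_cases)
  from Beta_plus1_left[OF this, of y]
  have "Beta (x + real (Suc k)) y = Beta (x + real k) y * ((x + real k) / (x + y + real k))"
    using assms by (simp add: field_simps)
  then show ?case
    unfolding Suc.IH by (simp add: pochhammer_Suc)
qed

lemma poly_pochhammer_linear:
  fixes c x :: real
  shows "poly (pochhammer [:c, 1:] j) x = pochhammer (c + x) j"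
  by (induction j) (simp_all add: pochhammer_Suc of_nat_poly algebra_simps)

lemma degree_pochhammer_linear_le: "degree (pochhammer [:c :: real, 1:] j) \<le> j"
proof (induction j)
  case (Suc j)
  have "degree (pochhammer [:c, 1:] j * ([:c, 1:] + of_nat j)) \<le>
      degree (pochhammer [:c, 1:] j) + degree ([:c, 1:] + of_nat j)"
    by (rule degree_mult_le)
  also have "degree ([:c, 1:] + of_nat j) \<le> 1"
    by (simp add: of_nat_poly)
  finally show ?case
    using Suc.IH by (simp add: pochhammer_Suc)
qed simp

text \<open>Each monomial contributes a Beta value. Rewriting \<open>(a+1+j)_k / (a+1)_k\<close> as
  \<open>(a+1+k)_j / (a+1)_j\<close> makes the moment an \<open>n\<close>-th difference in
  \<open>k\<close>.\<close>

lemma jacobi_integral_unit_jacobi_monom: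
  assumes "-1 < a" "-1 < b"
  shows "jacobi_integral a b (unit_jacobi a m n * monom 1 j) =
    Beta (a + 1 + real j) (b + 1) / pochhammer (a + 1) j *
    (\<Sum>k\<le>n. (-1) ^ k * real (n choose k) *
      (pochhammer (a + 1 + real k) j * (pochhammer m k / pochhammer (a + b + 2 + real j) k)))"
proof -
  have "jacobi_integral a b (unit_jacobi a m n * monom 1 j) =
     (\<Sum>k\<le>n. (-1) ^ k * real (n choose k) * (pochhammer m k / pochhammer (a + 1) k) *
       Beta (a + 1 + real j + real k) (b + 1))"
    unfolding unit_jacobi_def sum_distrib_right
    using assms by (simp add: mult_monom jacobi_integral_sum jacobi_integral_monom add_ac)
  also have "\<dots> = (\<Sum>k\<le>n. Beta (a + 1 + real j) (b + 1) / pochhammer (a + 1) j *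
    ((-1) ^ k * real (n choose k) *
      (pochhammer (a + 1 + real k) j * (pochhammer m k / pochhammer (a + b + 2 + real j) k))))"
  proof (rule sum.cong[OF refl])
    fix k
    have pos: "pochhammer (a + 1) k > 0" "pochhammer (a + 1) j > 0"
      using assms by (auto intro!: pochhammer_pos)
    have "pochhammer (a + 1 + real j) k / pochhammer (a + 1) k =
        pochhammer (a + 1 + real k) j / pochhammer (a + 1) j"
      using pos pochhammer_shift_swap[of "a + 1" j k] by (simp add: frac_eq_eq)
    moreover have "Beta (a + 1 + real j + real k) (b + 1) = Beta (a + 1 + real j) (b + 1) *
        (pochhammer (a + 1 + real j) k / pochhammer (a + b + 2 + real j) k)"
      using Beta_add_nat[of "a + 1 + real j" "b + 1" k] assms by (simp add: add_ac)
    moreover have "c * (p / q) * (B * (x / y)) = B / u * (c * (v * (p / y)))"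
      if "x / q = v / u" for c p q B x y u v :: real
    proof -
      have "c * (p / q) * (B * (x / y)) = c * p * B / y * (x / q)" by (simp add: mult_ac)
      also have "\<dots> = B / u * (c * (v * (p / y)))" unfolding that by (simp add: mult_ac)
      finally show ?thesis .
    qed
    ultimately show "(-1) ^ k * real (n choose k) * (pochhammer m k / pochhammer (a + 1) k) *
       Beta (a + 1 + real j + real k) (b + 1) = Beta (a + 1 + real j) (b + 1) / pochhammer (a + 1) j *
    ((-1) ^ k * real (n choose k) *
      (pochhammer (a + 1 + real k) j * (pochhammer m k / pochhammer (a + b + 2 + real j) k)))"
      by simp
  qed
  finally show ?thesis by (simp add: sum_distrib_left)
qed

text \<open>With \<open>s = a + b + 2 + j\<close> and \<open>i = n - 2 - j\<close> the parameter
  \<open>n + a + b\<close> is \<open>s + i\<close>, so the remaining quotient is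
  \<open>(s+k)_i / (s)_i\<close>. The summand is then a polynomial in \<open>k\<close> of degree at
  most \<open>i + j = n - 2\<close>, and its \<open>n\<close>-th difference vanishes.\<close>

lemma unit_jacobi_quasi_orthogonal:
  assumes "-1 < a" "-1 < b" "j + 2 \<le> n"
  shows "jacobi_integral a b (unit_jacobi a (real n + a + b) n * monom 1 j) = 0"
proof -
  define i where "i = n - 2 - j"
  have n: "real n = real i + real j + 2" using assms(3) by (simp add: i_def)
  define s where "s = a + b + 2 + real j"
  have s: "s > 0" using assms by (simp add: s_def)
  define q where "q = smult (1 / pochhammer s i) (pochhammer [:a + 1, 1:] j * pochhammer [:s, 1:] i)"
  have "degree q \<le> degree (pochhammer [:a + 1, 1:] j) + degree (pochhammer [:s, 1:] i)"
    unfolding q_def by (rule order_trans[OF degree_smult_le degree_mult_le])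
  also have "\<dots> \<le> j + i"
    by (intro add_mono degree_pochhammer_linear_le)
  finally have "degree q < n" using assms(3) by (simp add: i_def)
  have "pochhammer (a + 1 + real k) j * (pochhammer (real n + a + b) k / pochhammer (a + b + 2 + real j) k)
      = poly q (real k)" for k
  proof -
    have pos: "pochhammer s k > 0" "pochhammer s i > 0"
      using s by (auto intro!: pochhammer_pos)
    have "pochhammer (s + real i) k / pochhammer s k = pochhammer (s + real k) i / pochhammer s i"
      using pos pochhammer_shift_swap[of s i k] by (simp add: frac_eq_eq)
    moreover have "real n + a + b = s + real i" by (simp add: n s_def)
    ultimately show ?thesis
      by (simp add: q_def poly_pochhammer_linear flip: s_def)
  qed
  then show ?thesis
    using alternating_binomial_sum_poly[of q n] \<open>degree q < n\<close> assms
    by (simp add: jacobi_integral_unit_jacobi_monom)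
qed

text \<open>At \<open>j = n - 1\<close> the quotient is \<open>(m)_k / (m+1)_k = m / (m+k)\<close>,
  no longer a polynomial in \<open>k\<close>. Its pole yields a nonzero moment whose sign is
  opposite to that of the leading coefficient.\<close>

lemma unit_jacobi_boundary_moment:
  assumes "-1 < a" "-1 < b" "n \<ge> 2"
  shows "coeff (unit_jacobi a (real n + a + b) n) n *
    jacobi_integral a b (unit_jacobi a (real n + a + b) n * monom 1 (n - 1)) < 0"
proof -
  define m where "m = real n + a + b"
  have m: "m > 0" using assms by (simp add: m_def)
  define q where "q = pochhammer [:a + 1, 1:] (n - 1)"
  \<comment> \<open>Division of \<open>q\<close> by \<open>x + m\<close>: the quotient
    \<open>r\<close> has too small a degree to contribute, so only the remainder
    \<open>q(-m)\<close> survives.\<close>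
  have "[:m, 1:] dvd q - [:poly q (-m):]"
    using poly_eq_0_iff_dvd[of "q - [:poly q (-m):]" "-m"] by simp
  then obtain r where r: "q - [:poly q (-m):] = [:m, 1:] * r" by (elim dvdE)
  have "degree (q - [:poly q (-m):]) \<le> n - 1"
    unfolding q_def by (intro degree_diff_le degree_pochhammer_linear_le) simp
  then have "r = 0 \<or> degree r < n"
    using assms(3) unfolding r by (cases "r = 0") (auto simp: degree_mult_eq simp del: mult_pCons_left)
  then have zero: "(\<Sum>k\<le>n. (-1) ^ k * real (n choose k) * poly r (real k)) = 0"
    by (rule alternating_binomial_sum_poly)
  have "pochhammer (a + 1 + real k) (n - 1) * (pochhammer m k / pochhammer (a + b + 2 + real (n - 1)) k) =
     m * poly q (-m) * (1 / (m + real k)) + m * poly r (real k)" for k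
  proof -
    have pos: "pochhammer (m + 1) k > 0" "m + real k > 0"
      using m by (auto intro!: pochhammer_pos)
    have "poly q (real k) = poly q (-m) + (m + real k) * poly r (real k)"
      using arg_cong[OF r, of "\<lambda>p. poly p (real k)"] by (simp add: algebra_simps)
    then have "poly q (real k) * (m / (m + real k)) = m * poly q (-m) * (1 / (m + real k)) + m * poly r (real k)"
      using pos(2) by (simp add: field_simps)
    moreover have "pochhammer m k / pochhammer (m + 1) k = m / (m + real k)"
      using pos pochhammer_shift_swap[of m 1 k] by (simp add: frac_eq_eq mult_ac)
    moreover have "a + b + 2 + real (n - 1) = m + 1"
      using assms(3) by (simp add: m_def of_nat_diff)
    moreover have "pochhammer (a + 1 + real k) (n - 1) = poly q (real k)"
      unfolding q_def poly_pochhammer_linear ..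
    ultimately show ?thesis by (simp only:)
  qed
  then have "jacobi_integral a b (unit_jacobi a m n * monom 1 (n - 1)) =
      Beta (a + 1 + real (n - 1)) (b + 1) / pochhammer (a + 1) (n - 1) *
       (m * poly q (-m) * (\<Sum>k\<le>n. (-1) ^ k * real (n choose k) * (1 / (m + real k))) +
        m * (\<Sum>k\<le>n. (-1) ^ k * real (n choose k) * poly r (real k)))"
    using assms
    by (simp add: jacobi_integral_unit_jacobi_monom sum_distrib_left sum.distrib algebra_simps)
  also have "\<dots> = Beta (a + 1 + real (n - 1)) (b + 1) / pochhammer (a + 1) (n - 1) *
      (m * poly q (-m) * (fact n / pochhammer m (Suc n)))"
    unfolding zero alternating_binomial_sum_inverse[OF m] by simp
  finally have J: "jacobi_integral a b (unit_jacobi a m n * monom 1 (n - 1)) =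
     Beta (a + 1 + real (n - 1)) (b + 1) / pochhammer (a + 1) (n - 1) *
      (m * poly q (-m) * (fact n / pochhammer m (Suc n)))" .
  \<comment> \<open>At \<open>-m\<close> the \<open>n - 1\<close> factors of \<open>q\<close> are
    \<open>-(b+n-1), ..., -(b+1)\<close>, all negative.\<close>
  have "a + 1 + - m = - (b + real (n - 1))"
    using assms(3) by (simp add: m_def of_nat_diff)
  then have "poly q (-m) = pochhammer (- (b + real (n - 1))) (n - 1)"
    unfolding q_def poly_pochhammer_linear by (simp only:)
  also have "\<dots> = (-1) ^ (n - 1) * pochhammer (b + 1) (n - 1)"
    unfolding pochhammer_minus by simp
  finally have Q: "poly q (-m) = (-1) ^ (n - 1) * pochhammer (b + 1) (n - 1)" .
  have sgn: "(-1) ^ n * (-1) ^ (n - 1) = (-1 :: real)"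
    using assms(3) by (cases n) (auto simp flip: power_mult_distrib)
  have "Beta (a + 1 + real (n - 1)) (b + 1) > 0"
    using assms unfolding Beta_def by (intro divide_pos_pos mult_pos_pos Gamma_real_pos) auto
  then have pos: "pochhammer m n / pochhammer (a + 1) n *
     (Beta (a + 1 + real (n - 1)) (b + 1) / pochhammer (a + 1) (n - 1) *
      (m * pochhammer (b + 1) (n - 1) * (fact n / pochhammer m (Suc n)))) > 0"
    using assms m by (intro mult_pos_pos divide_pos_pos pochhammer_pos) auto
  have "coeff (unit_jacobi a m n) n * jacobi_integral a b (unit_jacobi a m n * monom 1 (n - 1)) =
    ((-1) ^ n * (-1) ^ (n - 1)) * (pochhammer m n / pochhammer (a + 1) n *
     (Beta (a + 1 + real (n - 1)) (b + 1) / pochhammer (a + 1) (n - 1) *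
      (m * pochhammer (b + 1) (n - 1) * (fact n / pochhammer m (Suc n)))))"
    unfolding J Q by (simp add: coeff_unit_jacobi)
  then show ?thesis
    using pos unfolding sgn m_def by simp
qed

section \<open>The energy identity\<close>

lemma coeff_one_minus_mult_Suc:
  fixes f :: "real poly"
  shows "coeff ([:1, -1:] * f) (Suc i) = coeff f (Suc i) - coeff f i"
  by simp

text \<open>Here \<open>\<nu> = c + i d\<close> and \<open>U = R + i S\<close>; \<open>eqR\<close>
  and \<open>eqS\<close> are the real and imaginary parts of \<open>U - \<nu> U' = p\<close>. The
  polynomial \<open>q\<close> stands for the part of \<open>R\<close> of degree at most
  \<open>n - 2\<close>. Since \<open>p\<close> is real, the integral of \<open>p (1-t) R'\<close> is
  the quantity estimated in two ways.\<close>

lemma unit_jacobi_energy_contradiction: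
  fixes R S q :: "real poly"
  assumes ab: "-1 < a" "a \<le> 0" "-1 < b" and n: "n \<ge> 2" and "c \<le> 0"
  defines "p \<equiv> unit_jacobi a (real n + a + b) n"
  assumes eqR: "R - smult c (pderiv R) + smult d (pderiv S) = p"
    and eqS: "S - smult c (pderiv S) - smult d (pderiv R) = 0"
    and R: "R = p + smult c (pderiv p) + q"
    and q: "\<And>i. n \<le> Suc i \<Longrightarrow> coeff q i = 0"
    and zero: "poly R 0 = 0" "poly S 0 = 0"
  shows False
proof -
  let ?L = "jacobi_integral a b" and ?w = "[:1, -1:] :: real poly"
  note lin = jacobi_integral_add[OF ab(1,3)] jacobi_integral_diff[OF ab(1,3)]
    jacobi_integral_smult[OF ab(1,3)]
  define M where "M = ?L (p * monom 1 (n - 1))"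
  have M: "coeff p n * M < 0"
    unfolding M_def p_def using ab n by (intro unit_jacobi_boundary_moment) auto
  obtain l where l: "n = Suc (Suc l)"
    using n by (metis One_nat_def Suc_1 Suc_le_D Suc_le_mono)
  have p0: "coeff p i = 0" if "i > n" for i
    using that by (simp add: p_def coeff_unit_jacobi)

  \<comment> \<open>The leading term of \<open>(1-t) R'\<close> equals that of \<open>-n p\<close>.
    Removing \<open>-n p\<close>, which contributes \<open>-n\<close> times the integral of
    \<open>p^2\<close>, leaves \<open>h\<close> of degree at most \<open>n - 1\<close>.\<close>
  define h where "h = ?w * pderiv p + smult (real n) p + smult c (?w * pderiv (pderiv p)) + ?w * pderiv q"
  have wR: "?w * pderiv R = smult (- real n) p + h"
    unfolding R h_def     by (subst poly_eq_poly_eq_iff[symmetric])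
       (simp add: fun_eq_iff pderiv_add pderiv_smult algebra_simps)
  have "coeff h (Suc i) = 0" if "Suc l \<le> i" for i
  proof (cases "i = Suc l")
    case True
    then show ?thesis
      unfolding h_def coeff_add coeff_smult coeff_one_minus_mult_Suc
      using l by (simp add: coeff_pderiv p0 q)
  next
    case False
    then show ?thesis
      unfolding h_def coeff_add coeff_smult coeff_one_minus_mult_Suc
      using l that by (simp add: coeff_pderiv p0 q)
  qed
  then have "degree h \<le> n - 1"
    using l by (intro degree_le allI impI) (metis Suc_lessE diff_Suc_1 less_Suc_eq_le)
  then have Lh: "?L (p * h) = coeff h (n - 1) * M"
    unfolding M_def p_def using ab n
    by (intro jacobi_integral_reduce_degree unit_jacobi_quasi_orthogonal) auto
  have "coeff h (n - 1) = real n * coeff p n + coeff p (n - 1) - c * (real n * (real n - 1) * coeff p n)"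
    unfolding l diff_Suc_1 h_def coeff_add coeff_smult coeff_one_minus_mult_Suc
    using l by (simp add: coeff_pderiv p0 q algebra_simps)
  \<comment> \<open>The ratio of the two top coefficients of \<open>p\<close> shows that this sum is
    a positive multiple of \<open>coeff p n\<close>. As \<open>c \<le> 0\<close>,
    \<open>coeff h (n - 1)\<close> then has the sign of \<open>coeff p n\<close>.\<close>
  moreover have "real n * coeff p n + coeff p (n - 1) =
      real n * (real n + b - 1) / (2 * real n + a + b - 1) * coeff p n"
  proof -
    define s where "s = pochhammer (real n + a + b) (Suc l) / pochhammer (a + 1) (Suc l)"
    have A: "coeff p n = (-1) ^ l * s * ((2 * real n + a + b - 1) / (a + real n))"
      by (simp add: p_def coeff_unit_jacobi l s_def pochhammer_Suc[of _ "Suc l"] add_ac)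
    have B: "coeff p (n - 1) = - ((-1) ^ l * s * real n)"
      by (simp add: p_def coeff_unit_jacobi l s_def)
    have "2 * real n + a + b - 1 > 0" "a + real n > 0" using ab n by auto
    then show ?thesis unfolding A B by (simp add: divide_simps) (simp add: algebra_simps)
  qed
  moreover have "(Y * z - c * (e * z)) * M = (z * M) * (Y + (- c) * e)" for Y e z
    by (simp add: algebra_simps)
  ultimately have "coeff h (n - 1) * M = (coeff p n * M) *
      (real n * (real n + b - 1) / (2 * real n + a + b - 1) + (- c) * (real n * (real n - 1)))"
    by (simp only:)
  moreover have "real n * (real n + b - 1) / (2 * real n + a + b - 1) > 0"
    using ab n by (intro divide_pos_pos mult_pos_pos) auto
  moreover have "(- c) * (real n * (real n - 1)) \<ge> 0"
    using \<open>c \<le> 0\<close> n by (intro mult_nonneg_nonneg) auto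
  ultimately have "?L (p * h) < 0"
    unfolding Lh using M by (simp only: mult_neg_pos add_pos_nonneg)
  moreover have "real n * ?L (p * p) \<ge> 0"
    using jacobi_integral_nonneg[OF ab(1,3), of "p * p"] by simp
  ultimately have "?L (p * (?w * pderiv R)) < 0"
    unfolding wR distrib_left mult_smult_right lin by linarith

  moreover have "?L (p * (?w * pderiv R)) \<ge> 0"
  proof -
    \<comment> \<open>Adding the zero product from \<open>eqS\<close> gives the real part of
      \<open>U - \<nu> U'\<close> times the conjugate of \<open>(1-t) U'\<close>. The terms in
      \<open>d\<close> cancel.\<close>
    have "p * (?w * pderiv R) =
       (R - smult c (pderiv R) + smult d (pderiv S)) * (?w * pderiv R) +
       (S - smult c (pderiv S) - smult d (pderiv R)) * (?w * pderiv S)"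
      unfolding eqR eqS by simp
    also have "\<dots> = ?w * (R * pderiv R) + ?w * (S * pderiv S) +
        smult (- c) (?w * ((pderiv R)\<^sup>2 + (pderiv S)\<^sup>2))"
      by (subst poly_eq_poly_eq_iff[symmetric])
         (simp add: fun_eq_iff algebra_simps power2_eq_square)
    finally have "?L (p * (?w * pderiv R)) = ?L (?w * (R * pderiv R)) + ?L (?w * (S * pderiv S)) +
        (- c) * ?L (?w * ((pderiv R)\<^sup>2 + (pderiv S)\<^sup>2))"
      by (simp only: lin)
    moreover have "?L (?w * ((pderiv R)\<^sup>2 + (pderiv S)\<^sup>2)) \<ge> 0"
    proof (rule jacobi_integral_nonneg[OF ab(1,3)])
      fix t :: real assume "t \<le> 1"
      then have "0 \<le> (1 - t) * ((poly (pderiv R) t)\<^sup>2 + (poly (pderiv S) t)\<^sup>2)"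
        by (intro mult_nonneg_nonneg) auto
      also have "\<dots> = poly (?w * ((pderiv R)\<^sup>2 + (pderiv S)\<^sup>2)) t"
        by (simp add: algebra_simps)
      finally show "0 \<le> poly (?w * ((pderiv R)\<^sup>2 + (pderiv S)\<^sup>2)) t" .
    qed
    moreover have "?L (?w * (R * pderiv R)) \<ge> 0" "?L (?w * (S * pderiv S)) \<ge> 0"
      using zero ab by (auto intro!: jacobi_integral_energy_nonneg simp del: mult_pCons_left)
    ultimately show ?thesis
      using \<open>c \<le> 0\<close> by (simp only: add_nonneg_nonneg mult_nonneg_nonneg neg_0_le_iff_le)
  qed
  ultimately show False by simp
qed

section \<open>Stability\<close>

lemma smult_sum_right: "smult c (\<Sum>i\<in>A. f i) = (\<Sum>i\<in>A. smult c (f i))"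
  by (induction A rule: infinite_finite_induct) (simp_all add: smult_add_right)

text \<open>\<open>(-n)_k / k!\<close> is the signed binomial coefficient, and
  \<open>n + a + (b - 1) + 1 = n + a + b\<close>.\<close>

lemma jacobi_poly_eq_unit_jacobi:
  "jacobi_poly a (b - 1) n =
    smult (pochhammer (a + 1) n / fact n) (pcompose (unit_jacobi a (real n + a + b) n) [:1/2, -1/2:])"
proof -
  have "pochhammer (- real n) k / fact k = (-1) ^ k * real (n choose k)" for k
    by (simp add: binomial_gbinomial gbinomial_pochhammer mult.assoc[symmetric] flip: power_mult_distrib)
  then have "pochhammer (- real n) k * x / (fact k * y) = (-1) ^ k * real (n choose k) * (x / y)" for k x y
    by (metis times_divide_times_eq)
  then show ?thesis
    unfolding jacobi_poly_def unit_jacobi_def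
    by (subst poly_eq_poly_eq_iff[symmetric])
       (simp add: fun_eq_iff poly_sum poly_pcompose poly_monom atLeast0AtMost add_ac)
qed

lemma higher_pderiv_pcompose_linear:
  fixes p :: "real poly"
  shows "(pderiv ^^ k) (pcompose p [:r, s:]) = smult (s ^ k) (pcompose ((pderiv ^^ k) p) [:r, s:])"
  by (induction k)
     (simp_all add: pderiv_smult pderiv_pcompose pderiv_pCons mult_ac)

text \<open>The point \<open>x = 1\<close> becomes \<open>t = 0\<close>, and the factor
  \<open>-1/2\<close> from each derivative is absorbed into \<open>- \<mu> / 2\<close>.\<close>

lemma Phi_at_1:
  "Phi a b n 1 \<mu> = complex_of_real (pochhammer (a + 1) n / fact n) *
    (\<Sum>k\<le>n. complex_of_real (poly ((pderiv ^^ k) (unit_jacobi a (real n + a + b) n)) 0) * (- \<mu> / 2) ^ k)"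
proof -
  have pow: "complex_of_real ((-1/2) ^ k) * \<mu> ^ k = (- \<mu> / 2) ^ k" for k
    by (simp add: power_mult_distrib[symmetric])
  have "complex_of_real (C * ((-1/2) ^ k * x)) * \<mu> ^ k = complex_of_real C * (complex_of_real x * (- \<mu> / 2) ^ k)"
    for C x k unfolding pow[symmetric] by (simp only: of_real_mult mult_ac)
  then show ?thesis
    unfolding Phi_def jacobi_poly_eq_unit_jacobi higher_pderiv_smult higher_pderiv_pcompose_linear
      poly_smult poly_pcompose sum_distrib_left atLeast0AtMost
    by (simp only: poly_pCons) simp
qed

theorem theorem4:
  fixes \<alpha> \<beta> :: real and n :: nat and \<mu> :: complex
  assumes "-1 < \<alpha>" and "\<alpha> < 0" and "-1 < \<beta>" and "n \<ge> 4"
    and "Phi \<alpha> \<beta> n 1 \<mu> = 0"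
  shows "Re \<mu> < 0"
proof (rule ccontr)
  assume "\<not> Re \<mu> < 0"
  define \<nu> where "\<nu> = - \<mu> / 2"
  define p where "p = unit_jacobi \<alpha> (real n + \<alpha> + \<beta>) n"
  define D where "D k = (pderiv ^^ k) p" for k
  \<comment> \<open>Since the \<open>D k\<close> are real, \<open>R\<close> and \<open>S\<close> are
    the real and imaginary parts of \<open>U\<close>.\<close>
  define R where "R = (\<Sum>k\<le>n. smult (Re (\<nu> ^ k)) (D k))"
  define S where "S = (\<Sum>k\<le>n. smult (Im (\<nu> ^ k)) (D k))"
  have D: "D 0 = p" "pderiv (D k) = D (Suc k)" for k
    by (simp_all add: D_def)
  have coeff_D: "coeff (D k) i = 0" if "k + i > n" for k i
    using that by (simp add: D_def coeff_higher_pderiv p_def coeff_unit_jacobi add.commute)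
  have Dn: "D (Suc n) = 0"
    by (intro poly_eqI) (simp add: coeff_D)
  have dR: "pderiv R = (\<Sum>k\<le>n. smult (Re (\<nu> ^ k)) (D (Suc k)))"
    and dS: "pderiv S = (\<Sum>k\<le>n. smult (Im (\<nu> ^ k)) (D (Suc k)))"
    unfolding R_def S_def higher_pderiv_sum[of 1, simplified] by (simp_all add: pderiv_smult D)
  have "pochhammer (\<alpha> + 1) n > 0"
    using assms by (intro pochhammer_pos) auto
  then have zero: "(\<Sum>k\<le>n. complex_of_real (poly (D k) 0) * \<nu> ^ k) = 0"
    using assms(5) by (auto simp: Phi_at_1 D_def p_def \<nu>_def)
  \<comment> \<open>The terms from the second derivative on have degree at most
    \<open>n - 2\<close>.\<close>
  let ?q = "\<Sum>k=2..n. smult (Re (\<nu> ^ k)) (D k)"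
  show False
  proof (rule unit_jacobi_energy_contradiction[where a = \<alpha> and b = \<beta> and n = n
        and c = "Re \<nu>" and d = "Im \<nu>" and R = R and S = S and q = ?q])
    show "Re \<nu> \<le> 0" using \<open>\<not> Re \<mu> < 0\<close> by (simp add: \<nu>_def)
    show "poly R 0 = 0"
      using arg_cong[OF zero, of Re] by (simp add: R_def poly_sum mult.commute)
    show "poly S 0 = 0"
      using arg_cong[OF zero, of Im] by (simp add: S_def poly_sum mult.commute)
    have "R - smult (Re \<nu>) (pderiv R) + smult (Im \<nu>) (pderiv S) =
        (\<Sum>k\<le>n. smult (Re (\<nu> ^ k)) (D k) - smult (Re (\<nu> ^ Suc k)) (D (Suc k)))"
      unfolding dR dS unfolding R_def
      by (simp add: smult_sum_right sum_subtractf sum.distrib smult_diff_left)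
    also have "\<dots> = p"
      \<comment> \<open>The sum collapses to its \<open>k = 0\<close> term, because the derivative
        of order \<open>n + 1\<close> of \<open>p\<close> is 0.\<close>
      by (subst sum_telescope) (simp add: D Dn)
    finally show "R - smult (Re \<nu>) (pderiv R) + smult (Im \<nu>) (pderiv S) =
        unit_jacobi \<alpha> (real n + \<alpha> + \<beta>) n" unfolding p_def .
    have "S - smult (Re \<nu>) (pderiv S) - smult (Im \<nu>) (pderiv R) =
        (\<Sum>k\<le>n. smult (Im (\<nu> ^ k)) (D k) - smult (Im (\<nu> ^ Suc k)) (D (Suc k)))"
      unfolding dR dS unfolding S_def
      by (simp add: smult_sum_right sum_subtractf sum.distrib smult_add_left)
    also have "\<dots> = 0"
      by (subst sum_telescope) (simp add: D Dn)
    finally show "S - smult (Re \<nu>) (pderiv S) - smult (Im \<nu>) (pderiv R) = 0" .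
    have "{..n} = {0, 1} \<union> {2..n}" using assms(4) by auto
    then have "R = p + smult (Re \<nu>) (pderiv p) + ?q"
      unfolding R_def by (simp add: sum.union_disjoint flip: D)
    then show "R = unit_jacobi \<alpha> (real n + \<alpha> + \<beta>) n +
        smult (Re \<nu>) (pderiv (unit_jacobi \<alpha> (real n + \<alpha> + \<beta>) n)) + ?q"
      unfolding p_def .
    show "coeff ?q i = 0" if "n \<le> Suc i" for i
      using that by (auto simp: coeff_sum coeff_D intro!: sum.neutral)
  qed (use assms in auto)
qed

end
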